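(* Let $0<q<1$, let $a$ be a positive real number, and let $u,v>0$ be such that the $q$-integral defining $(N_q E_q(at))(u;v)$ exists. Then $$\left(N_q E_q(at)\right)(u;v)=\frac1v\sum_{n=0}^{\infty}q^{\frac{n(n-1)}{2}}\left(\frac{au}{v}\right)^{n}.$$
   Context: Fix $0<q<1$. Write $[n]_q=\frac{1-q^n}{1-q}$, $[n]_q!=[n]_q[n-1]_q\cdots[1]_q$, $[0]_q!=1$, and $E_q(x)=\sum_{n=0}^{\infty}q^{n(n-1)/2}\frac{x^n}{[n]_q!}$ (an entire function). The Jackson $q$-integral is $\int_0^{\infty}f(t)\,d_qt=(1-q)\sum_{k\in\mathbb{Z}}q^kf(q^k)$, provided the sum converges absolutely. The $q$-Natural transform of first kind of a function $f$ on $(0,\infty)$ is, for $u,v>0$, $$(N_qf)(u;v)=\frac1u\int_0^{\infty}f(t)\,E_q\!\left(-q\frac{v}{u}t\right)d_qt=\frac{1-q}{u}\sum_{k\in\mathbb{Z}}q^kf(q^k)E_q\!\left(-q^{k+1}\frac{v}{u}\right).$$ The $q$-integral is said to exist at $(u;v)$ if this series converges absolutely. $N_qE_q(at)$ denotes the transform of $t\mapsto E_q(at)$. *)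

theory Defs
  imports "HOL-Analysis.Analysis"
begin

definition q_bracket :: "real \<Rightarrow> nat \<Rightarrow> real" where
  "q_bracket q n = (1 - q ^ n) / (1 - q)"

definition q_fact :: "real \<Rightarrow> nat \<Rightarrow> real" where
  "q_fact q n = (\<Prod>k=1..n. q_bracket q k)"

text \<open>The exponent \<open>n * (n - 1) div 2\<close> is an exact division, also for \<open>n = 0\<close>
  with truncated subtraction.\<close>

definition E_q :: "real \<Rightarrow> real \<Rightarrow> real" where
  "E_q q x = (\<Sum>n. q ^ (n * (n - 1) div 2) * (x ^ n / q_fact q n))"

text \<open>The bilateral series defining the Jackson integral over \<open>(0, \<infinity>)\<close> samples the
  integrand at all integer powers of \<open>q\<close>. The integral exists iff this series converges
  absolutely; otherwise \<open>infsum\<close> returns the default value \<open>0\<close>.\<close>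

definition jackson_integrable :: "real \<Rightarrow> (real \<Rightarrow> real) \<Rightarrow> bool" where
  "jackson_integrable q f \<longleftrightarrow>
     (\<lambda>k::int. \<bar>q powi k * f (q powi k)\<bar>) summable_on UNIV"

definition jackson_integral :: "real \<Rightarrow> (real \<Rightarrow> real) \<Rightarrow> real" where
  "jackson_integral q f = (1 - q) * (\<Sum>\<^sub>\<infinity>k::int. q powi k * f (q powi k))"

definition q_natural_integrand ::
  "real \<Rightarrow> (real \<Rightarrow> real) \<Rightarrow> real \<Rightarrow> real \<Rightarrow> real \<Rightarrow> real" where
  "q_natural_integrand q f u v t = f t * E_q q (- q * (v / u) * t)"

definition q_natural_exists :: "real \<Rightarrow> (real \<Rightarrow> real) \<Rightarrow> real \<Rightarrow> real \<Rightarrow> bool" where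
  "q_natural_exists q f u v \<longleftrightarrow> jackson_integrable q (q_natural_integrand q f u v)"

definition q_natural :: "real \<Rightarrow> (real \<Rightarrow> real) \<Rightarrow> real \<Rightarrow> real \<Rightarrow> real" where
  "q_natural q f u v = 1 / u * jackson_integral q (q_natural_integrand q f u v)"

end

theory Submission
  imports Defs
begin

text \<open>
  Put \<open>w = v / u\<close> and write \<open>F k = E_q (- q w q\<^sup>k)\<close> for the kernel at the \<open>k\<close>-th sample point.
  The functional equation \<open>E_q x = (1 + (1 - q) x) E_q (q x)\<close> turns into
  \<open>F k = (1 - (1 - q) w q\<^bsup>k+1\<^esup>) F (k + 1)\<close>, and continuity of \<open>E_q\<close> at \<open>0\<close> gives
  \<open>F k \<longlongrightarrow> 1\<close> as \<open>k\<close> tends to infinity. Everything about the kernel follows from these two facts.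

  The hypothesis that the integral exists is very restrictive. As \<open>k\<close> decreases the factors of
  the recurrence grow without bound, so if none of them vanishes then \<open>\<bar>F k\<bar>\<close> stays away from
  \<open>0\<close> as \<open>k\<close> tends to minus infinity; since \<open>q\<^sup>k\<close> and \<open>E_q (a q\<^sup>k)\<close> are at least \<open>1\<close> there,
  the series diverges. Hence some factor vanishes: \<open>(1 - q) w q\<^sup>b = 1\<close> for an integer \<open>b\<close>
  (lemma \<open>q_natural_exists_imp_lattice_zero\<close>). Then \<open>F k = 0\<close> for \<open>k < b\<close>, and the bilateral
  series becomes a one-sided one over \<open>G i = F (b + i)\<close>, where
  \<open>G i = (1 - q\<^bsup>i+1\<^esup>) G (i + 1)\<close>; that is, \<open>G i\<close> is the infinite product of
  \<open>1 - q\<^sup>j\<close> over \<open>j > i\<close>.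

  The moments \<open>\<Sum>i. q\<^bsup>i(n+1)\<^esup> G i\<close> equal \<open>(1 - q)\<^sup>n [n]\<^sub>q!\<close>
  (lemma \<open>pochhammer_tail_moments\<close>), a discrete form of \<open>\<Gamma> (n + 1) = n!\<close>. Expanding \<open>E_q (a t)\<close> in
  powers of \<open>t\<close> and interchanging the sums, which is legitimate because all terms are
  nonnegative, the factor \<open>[n]\<^sub>q!\<close> cancels against the coefficient of \<open>E_q\<close>. What remains is the
  asserted series, as \<open>(1 - q) q\<^sup>b = u / v\<close>.
\<close>

section \<open>The entire function \<open>E_q\<close>\<close>

lemma triangular_exponent_Suc: "Suc n * (Suc n - 1) div 2 = n * (n - 1) div 2 + n"
proof -
  have "Suc n * (Suc n - 1) = n * (n - 1) + n * 2"
    by (cases n) (auto simp: algebra_simps)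
  then show ?thesis by simp
qed

lemma summable_partial_theta:
  fixes q x :: real
  assumes "0 < q" "q < 1"
  shows "summable (\<lambda>n. q ^ (n * (n - 1) div 2) * x ^ n)"
proof -
  have "(\<lambda>n. q ^ n * \<bar>x\<bar>) \<longlonglongrightarrow> 0 * \<bar>x\<bar>"
    using assms by (intro tendsto_intros LIMSEQ_realpow_zero) auto
  then have "eventually (\<lambda>n. q ^ n * \<bar>x\<bar> < 1 / 2) sequentially"
    by (intro order_tendstoD(2)) auto
  then obtain N where N: "\<And>n. n \<ge> N \<Longrightarrow> q ^ n * \<bar>x\<bar> < 1 / 2"
    by (auto simp: eventually_at_top_linorder)
  show ?thesis
  proof (rule summable_ratio_test[of "1 / 2" N])
    fix n assume "n \<ge> N"
    have "norm (q ^ (Suc n * (Suc n - 1) div 2) * x ^ Suc n)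
            = (q ^ n * \<bar>x\<bar>) * norm (q ^ (n * (n - 1) div 2) * x ^ n)"
      unfolding triangular_exponent_Suc using assms
      by (simp add: power_add abs_mult power_abs)
    also have "\<dots> \<le> 1 / 2 * norm (q ^ (n * (n - 1) div 2) * x ^ n)"
      using N[OF \<open>n \<ge> N\<close>] by (intro mult_right_mono) auto
    finally show "norm (q ^ (Suc n * (Suc n - 1) div 2) * x ^ Suc n)
                    \<le> 1 / 2 * norm (q ^ (n * (n - 1) div 2) * x ^ n)" .
  qed simp
qed

lemma q_fact_Suc: "q_fact q (Suc n) = q_fact q n * q_bracket q (Suc n)"
  by (simp add: q_fact_def)

lemma q_fact_ge_1:
  assumes "0 < q" "q < 1"
  shows "1 \<le> q_fact q n"
  unfolding q_fact_def
proof (rule prod_ge_1)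
  fix k assume "k \<in> {1..n}"
  then have "q ^ k \<le> q ^ 1"
    using assms by (intro power_decreasing) auto
  then show "1 \<le> q_bracket q k"
    using assms by (simp add: q_bracket_def)
qed

definition E_q_coeff :: "real \<Rightarrow> nat \<Rightarrow> real" where
  "E_q_coeff q n = q ^ (n * (n - 1) div 2) / q_fact q n"

lemma E_q_eq_powser: "E_q q x = (\<Sum>n. E_q_coeff q n * x ^ n)"
  by (simp add: E_q_def E_q_coeff_def)

lemma E_q_coeff_nonneg: "0 < q \<Longrightarrow> q < 1 \<Longrightarrow> 0 \<le> E_q_coeff q n"
  using q_fact_ge_1[of q n] by (simp add: E_q_coeff_def)

lemma E_q_coeff_0: "E_q_coeff q 0 = 1"
  by (simp add: E_q_coeff_def q_fact_def)

lemma E_q_coeff_Suc: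
  assumes "0 < q" "q < 1"
  shows "E_q_coeff q (Suc n) * (1 - q ^ Suc n) = (1 - q) * q ^ n * E_q_coeff q n"
proof -
  have "q ^ Suc n < 1"
    using assms by (rule power_Suc_less_one)
  then have "1 - q ^ Suc n \<noteq> 0" by simp
  moreover have "q_fact q n \<noteq> 0" "1 - q \<noteq> 0"
    using q_fact_ge_1[OF assms, of n] assms by auto
  ultimately show ?thesis
    unfolding E_q_coeff_def triangular_exponent_Suc q_fact_Suc q_bracket_def power_add
    by (simp add: divide_simps)
qed

lemma summable_E_q:
  assumes "0 < q" "q < 1"
  shows "summable (\<lambda>n. E_q_coeff q n * x ^ n)"
proof (rule summable_comparison_test')
  show "summable (\<lambda>n. q ^ (n * (n - 1) div 2) * \<bar>x\<bar> ^ n)"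
    by (rule summable_partial_theta[OF assms])
  fix n :: nat
  have "E_q_coeff q n \<le> q ^ (n * (n - 1) div 2) / 1"
    unfolding E_q_coeff_def
    using q_fact_ge_1[OF assms, of n] assms by (intro divide_left_mono) auto
  then show "norm (E_q_coeff q n * x ^ n) \<le> q ^ (n * (n - 1) div 2) * \<bar>x\<bar> ^ n"
    using E_q_coeff_nonneg[OF assms, of n]
    by (simp add: abs_mult power_abs mult_right_mono)
qed

lemma E_q_0: "E_q q 0 = 1"
  unfolding E_q_eq_powser powser_zero by (rule E_q_coeff_0)

lemma E_q_ge_1:
  assumes "0 < q" "q < 1" "0 \<le> x"
  shows "1 \<le> E_q q x"
proof -
  have "(\<Sum>n<1. E_q_coeff q n * x ^ n) \<le> E_q q x"
    unfolding E_q_eq_powser using assms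
    by (intro sum_le_suminf summable_E_q) (auto intro: mult_nonneg_nonneg E_q_coeff_nonneg)
  then show ?thesis by (simp add: E_q_coeff_0)
qed

text \<open>Comparing coefficients in \<open>E_q x - E_q (q x) = (1 - q) x E_q (q x)\<close>, the
  \<open>q\<close>-difference equation of which \<open>exp' = exp\<close> is the limit as \<open>q\<close> tends to \<open>1\<close>.\<close>

lemma E_q_functional_equation:
  assumes "0 < q" "q < 1"
  shows "E_q q x = (1 + (1 - q) * x) * E_q q (q * x)"
proof -
  let ?e = "E_q_coeff q"
  have E: "(\<lambda>n. ?e n * y ^ n) sums E_q q y" for y
    unfolding E_q_eq_powser by (rule summable_sums[OF summable_E_q[OF assms]])
  have "(\<lambda>n. (1 - q) * x * (?e n * (q * x) ^ n)) sums ((1 - q) * x * E_q q (q * x))"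
    by (rule sums_mult[OF E])
  also have "(\<lambda>n. (1 - q) * x * (?e n * (q * x) ^ n))
               = (\<lambda>n. ?e (Suc n) * (1 - q ^ Suc n) * x ^ Suc n)"
    unfolding E_q_coeff_Suc[OF assms] by (simp add: power_mult_distrib algebra_simps)
  finally have "(\<lambda>n. ?e n * (1 - q ^ n) * x ^ n) sums ((1 - q) * x * E_q q (q * x))"
    by (rule sums_Suc_imp[rotated]) simp
  moreover have "(\<lambda>n. ?e n * (1 - q ^ n) * x ^ n) sums (E_q q x - E_q q (q * x))"
    using sums_diff[OF E[of x] E[of "q * x"]]
    by (simp add: power_mult_distrib algebra_simps)
  ultimately have "(1 - q) * x * E_q q (q * x) = E_q q x - E_q q (q * x)"
    by (rule sums_unique2)
  then show ?thesis by (simp add: algebra_simps)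
qed

lemma E_q_along_powers_tendsto_1:
  assumes "0 < q" "q < 1"
  shows "(\<lambda>n. E_q q (x * q ^ n)) \<longlonglongrightarrow> 1"
proof -
  have "isCont (E_q q) 0"
    using isCont_powser_converges_everywhere[OF summable_E_q[OF assms], of 0]
    by (simp add: E_q_eq_powser[abs_def])
  moreover have "(\<lambda>n. x * q ^ n) \<longlonglongrightarrow> x * 0"
    using assms by (intro tendsto_intros LIMSEQ_realpow_zero) auto
  ultimately show ?thesis
    using isCont_tendsto_compose[of 0 "E_q q" "\<lambda>n. x * q ^ n" sequentially] by (simp add: E_q_0)
qed

section \<open>Sequences on the lattice of powers of \<open>q\<close>\<close>

text \<open>A zero of \<open>F\<close> would propagate to the right and contradict the limit \<open>1\<close>, so \<open>F\<close> has no
  zeros. Going left, \<open>F\<close> is multiplied by factors whose modulus is eventually at least \<open>1\<close>.\<close>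

lemma backward_recurrence_bounded_below:
  fixes F :: "int \<Rightarrow> real"
  assumes q: "0 < q" "q < 1" and "0 < c"
    and F: "\<And>k. F k = (1 - c * q powi (k + 1)) * F (k + 1)"
    and lim: "(\<lambda>n. F (int n)) \<longlonglongrightarrow> 1"
    and no_zero: "\<And>k. c * q powi k \<noteq> 1"
  obtains d N where "0 < d" "\<And>n. n \<ge> N \<Longrightarrow> d \<le> \<bar>F (- int n)\<bar>"
proof -
  have nz: "F k \<noteq> 0" for k
  proof
    assume "F k = 0"
    have zero: "F (k + int n) = 0" for n
    proof (induction n)
      case (Suc n)
      then show ?case
        using F[of "k + int n"] no_zero[of "k + int n + 1"] by (auto simp: algebra_simps)
    qed (use \<open>F k = 0\<close> in simp)
    have "F (int n) = 0" if "n \<ge> nat \<bar>k\<bar>" for n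
    proof -
      have "k + int (nat (int n - k)) = int n" using that by linarith
      with zero[of "nat (int n - k)"] show ?thesis by (simp only:)
    qed
    then have "(\<lambda>n. F (int n)) \<longlonglongrightarrow> 0"
      by (intro tendsto_eventually) (auto simp: eventually_at_top_linorder)
    with lim show False using LIMSEQ_unique by fastforce
  qed
  \<comment> \<open>From \<open>N\<close> on, \<open>c q\<^bsup>-n\<^esup> > 2\<close>, so the factor \<open>1 - c q\<^bsup>-n\<^esup>\<close> lies below \<open>-1\<close>.\<close>
  have "1 < 1 / q" using q by simp
  then obtain N where N: "2 / c < (1 / q) ^ N"
    using real_arch_pow by blast
  have "\<bar>F (- int N)\<bar> \<le> \<bar>F (- int n)\<bar>" if "n \<ge> N" for n
    using that
  proof (induction n rule: dec_induct)
    case (step n)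
    have "(1 / q) ^ N \<le> (1 / q) ^ n"
      using \<open>1 < 1 / q\<close> step by (intro power_increasing) auto
    with N have "2 / c < (1 / q) ^ n" by linarith
    also have "(1 / q) ^ n = q powi (- int n)"
      by (simp add: power_int_minus power_one_over field_simps)
    finally have "1 \<le> \<bar>1 - c * q powi (- int n)\<bar>"
      using \<open>0 < c\<close> by (simp add: field_simps)
    then have "1 * \<bar>F (- int n)\<bar> \<le> \<bar>1 - c * q powi (- int n)\<bar> * \<bar>F (- int n)\<bar>"
      by (intro mult_right_mono) auto
    also have "\<dots> = \<bar>F (- int (Suc n))\<bar>"
      using F[of "- int (Suc n)"] by (simp add: abs_mult)
    finally show ?case using step.IH by simp
  qed simp
  with nz[of "- int N"] show thesis
    by (intro that[of "\<bar>F (- int N)\<bar>" N]) auto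
qed

text \<open>The recurrence and the limit determine \<open>G i\<close> as the product of \<open>1 - q\<^sup>j\<close> over \<open>j > i\<close>, the
  tail of the infinite \<open>q\<close>-Pochhammer product. Its sign is that of the limit, since going left
  multiplies by positive factors.\<close>

lemma pochhammer_tail_nonneg:
  fixes G :: "nat \<Rightarrow> real"
  assumes q: "0 < q" "q < 1"
    and G: "\<And>i. G i = (1 - q ^ Suc i) * G (Suc i)"
    and lim: "G \<longlonglongrightarrow> 1"
  shows "0 \<le> G i"
proof -
  have "eventually (\<lambda>n. 0 < G n) sequentially"
    using lim by (rule order_tendstoD) simp
  then obtain N where N: "\<And>n. n \<ge> N \<Longrightarrow> 0 < G n"
    by (auto simp: eventually_at_top_linorder)
  have "0 \<le> G (i + k) \<Longrightarrow> 0 \<le> G i" for k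
  proof (induction k)
    case (Suc k)
    have "q ^ Suc (i + k) \<le> 1"
      using q by (intro power_le_one) auto
    with Suc show ?case
      using G[of "i + k"] by simp
  qed simp
  from this[of N] N[of "i + N"] show ?thesis by simp
qed

text \<open>For \<open>n = 0\<close> the terms are the differences \<open>G i - G (i - 1)\<close>, and the sum telescopes to the
  limit of \<open>G\<close>. Writing \<open>S n\<close> for the \<open>n\<close>-th moment, the identity \<open>(1 - q\<^sup>i) G i = G (i - 1)\<close> and a
  shift of the index give \<open>S n - S (n + 1) = q\<^bsup>n+1\<^esup> S n\<close>, the analogue of integrating by parts in
  the Gamma integral.\<close>

lemma pochhammer_tail_moments:
  fixes G :: "nat \<Rightarrow> real"
  assumes q: "0 < q" "q < 1"
    and G: "\<And>i. G i = (1 - q ^ Suc i) * G (Suc i)"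
    and lim: "G \<longlonglongrightarrow> 1"
  shows "(\<lambda>i. q ^ (i * Suc n) * G i) sums ((1 - q) ^ n * q_fact q n)"
proof (induction n)
  case 0
  have "(\<lambda>i. q ^ Suc i * G (Suc i)) = (\<lambda>i. G (Suc i) - G i)"
    by (subst G) (simp add: algebra_simps)
  then have "(\<lambda>i. q ^ Suc i * G (Suc i)) sums (1 - G 0)"
    using telescope_sums[OF lim] by simp
  from sums_Suc[OF this] show ?case by (simp add: q_fact_def)
next
  case (Suc n)
  let ?t = "\<lambda>i. q ^ (i * Suc n) * G i" and ?S = "(1 - q) ^ n * q_fact q n"
  let ?shift = "\<lambda>i. if i = 0 then 0 else q ^ Suc n * ?t (i - 1)"
  have "?shift sums (q ^ Suc n * ?S)"
    by (rule sums_Suc_imp) (use sums_mult[OF Suc, of "q ^ Suc n"] in simp_all)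
  from sums_diff[OF Suc this]
  have "(\<lambda>i. ?t i - ?shift i) sums ((1 - q ^ Suc n) * ?S)"
    by (simp add: algebra_simps)
  moreover have "?t i - ?shift i = q ^ (i * Suc (Suc n)) * G i" for i
  proof (cases i)
    case (Suc j)
    have "?t i - ?shift i = q ^ (i * Suc n) * (G (Suc j) - G j)"
      using Suc by (simp add: power_add algebra_simps)
    also have "G (Suc j) - G j = q ^ i * G i"
      using G[of j] Suc by (simp add: algebra_simps)
    finally show ?thesis by (simp add: power_add algebra_simps)
  qed simp
  moreover have "(1 - q ^ Suc n) * ?S = (1 - q) ^ Suc n * q_fact q (Suc n)"
    using q by (simp add: q_fact_Suc q_bracket_def)
  ultimately show ?case by (simp only:)
qed

text \<open>Tonelli for series. The conclusion is unordered summation, because the result is transported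
  to a sum over the integers.\<close>

lemma sums_swap_nonneg:
  fixes A :: "nat \<Rightarrow> nat \<Rightarrow> real"
  assumes nonneg: "\<And>i n. 0 \<le> A i n"
    and col: "\<And>n. (\<lambda>i. A i n) sums c n" and total: "c sums C"
    and row: "\<And>i. (\<lambda>n. A i n) sums r i"
  shows "(r has_sum C) UNIV"
proof -
  let ?f = "\<lambda>(n, i). A i n"
  have col': "((\<lambda>i. ?f (n, i)) has_sum c n) UNIV" for n
    using sums_nonneg_imp_has_sum[OF col] nonneg by simp
  have "0 \<le> c n" for n
    using sums_le[OF _ sums_zero col] nonneg by auto
  then have total': "(c has_sum C) UNIV"
    by (intro sums_nonneg_imp_has_sum total)
  have "?f summable_on UNIV \<times> UNIV"
    by (rule summable_on_SigmaI[OF col' has_sum_imp_summable[OF total']]) (auto simp: nonneg)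
  then have "(?f has_sum C) (UNIV \<times> UNIV)"
    by (rule has_sum_SigmaI[OF col' total'])
  then have "((\<lambda>(i, n). A i n) has_sum C) (UNIV \<times> UNIV)"
    by (subst (asm) has_sum_swap) (simp add: case_prod_unfold)
  then show ?thesis
    by (rule has_sum_SigmaD) (use sums_nonneg_imp_has_sum[OF row] nonneg in auto)
qed

section \<open>The \<open>q\<close>-Natural transform of \<open>E_q\<close>\<close>

text \<open>For \<open>w = v / u\<close> this is the factor that multiplies \<open>f (q\<^sup>k)\<close> in the integrand.\<close>

definition q_kernel :: "real \<Rightarrow> real \<Rightarrow> int \<Rightarrow> real" where
  "q_kernel q w k = E_q q (- q * w * q powi k)"

lemma q_kernel_recurrence:
  assumes "0 < q" "q < 1"
  shows "q_kernel q w k = (1 - (1 - q) * w * q powi (k + 1)) * q_kernel q w (k + 1)"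
proof -
  have "q powi (k + 1) = q * q powi k"
    using assms by (simp add: power_int_add)
  then show ?thesis
    unfolding q_kernel_def
    by (subst E_q_functional_equation[OF assms]) (simp add: algebra_simps)
qed

lemma q_kernel_tendsto_1:
  assumes "0 < q" "q < 1"
  shows "(\<lambda>n. q_kernel q w (b + int n)) \<longlonglongrightarrow> 1"
  using E_q_along_powers_tendsto_1[OF assms, of "- q * w * q powi b"] assms
  by (simp add: q_kernel_def power_int_add mult.assoc)

text \<open>If no sample point hits a zero of the kernel, then all factors in the terms of the series are
  bounded away from \<open>0\<close> as \<open>k\<close> tends to minus infinity, and the series cannot converge.\<close>

lemma q_natural_exists_imp_lattice_zero:
  assumes "0 < q" "q < 1" "0 < a" "0 < u" "0 < v"
    and ex: "q_natural_exists q (\<lambda>t. E_q q (a * t)) u v"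
  obtains b where "(1 - q) * (v / u) * q powi b = 1"
proof (rule ccontr)
  note q = \<open>0 < q\<close> \<open>q < 1\<close>
  assume "\<not> thesis"
  with that have no_zero: "(1 - q) * (v / u) * q powi k \<noteq> 1" for k by blast
  have "0 < (1 - q) * (v / u)" using assms by simp
  moreover have "(\<lambda>n. q_kernel q (v / u) (int n)) \<longlonglongrightarrow> 1"
    using q_kernel_tendsto_1[OF q, of "v / u" 0] by simp
  ultimately obtain d N
    where d: "0 < d" "\<And>n. n \<ge> N \<Longrightarrow> d \<le> \<bar>q_kernel q (v / u) (- int n)\<bar>"
    using backward_recurrence_bounded_below[OF q _ q_kernel_recurrence[OF q] _ no_zero] by blast
  define T where "T k = \<bar>q powi k * (E_q q (a * q powi k) * q_kernel q (v / u) k)\<bar>" for k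
  have "T summable_on UNIV"
    using ex by (simp add: q_natural_exists_def jackson_integrable_def
      q_natural_integrand_def T_def[abs_def] q_kernel_def)
  then have "T summable_on range (\<lambda>n::nat. - int n)"
    by (rule summable_on_subset_banach) simp
  then have "(\<lambda>n. T (- int n)) summable_on UNIV"
    by (subst (asm) summable_on_reindex) (auto simp: inj_on_def o_def)
  then have "(\<lambda>n. T (- int n)) \<longlonglongrightarrow> 0"
    by (intro summable_LIMSEQ_zero summable_on_imp_summable)
  moreover have "d \<le> T (- int n)" if "n \<ge> N" for n
  proof -
    have "1 \<le> q powi (- int n)"
      using q by (simp add: power_int_minus one_le_inverse power_le_one)
    moreover have "1 \<le> E_q q (a * q powi (- int n))"
      using assms by (intro E_q_ge_1) auto
    ultimately have "1 * 1 \<le> q powi (- int n) * E_q q (a * q powi (- int n))"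
      by (intro mult_mono) auto
    then have "1 * \<bar>q_kernel q (v / u) (- int n)\<bar>
        \<le> \<bar>q powi (- int n) * E_q q (a * q powi (- int n))\<bar> * \<bar>q_kernel q (v / u) (- int n)\<bar>"
      by (intro mult_right_mono) auto
    with d(2)[OF that] show ?thesis
      by (simp add: T_def abs_mult mult.assoc)
  qed
  ultimately have "d \<le> 0"
    by (intro LIMSEQ_le_const) auto
  with \<open>0 < d\<close> show False by simp
qed

text \<open>The vanishing factor occurs in the step from \<open>b\<close> to \<open>b - 1\<close>, and the zero it creates is
  inherited by every smaller index.\<close>

lemma q_kernel_eq_0_below_lattice_zero:
  assumes "0 < q" "q < 1" and b: "(1 - q) * w * q powi b = 1" and "k < b"
  shows "q_kernel q w k = 0"
proof -
  have "q_kernel q w (b - 1 - int n) = 0" for n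
  proof (induction n)
    case 0
    show ?case using q_kernel_recurrence[OF assms(1,2), of w "b - 1"] b by simp
  next
    case (Suc n)
    have "b - 1 - int (Suc n) + 1 = b - 1 - int n" by simp
    then show ?case
      using q_kernel_recurrence[OF assms(1,2), of w "b - 1 - int (Suc n)"] Suc
      by (simp only: mult_zero_right)
  qed
  from this[of "nat (b - 1 - k)"] \<open>k < b\<close> show ?thesis by simp
qed

lemma has_sum_int_above:
  fixes f :: "int \<Rightarrow> real"
  assumes "((\<lambda>i. f (b + int i)) has_sum S) UNIV" and "\<And>k. k < b \<Longrightarrow> f k = 0"
  shows "(f has_sum S) UNIV"
proof -
  have "k \<in> range (\<lambda>i. b + int i)" if "b \<le> k" for k
    using that by (intro image_eqI[of _ _ "nat (k - b)"]) auto
  then have "(f has_sum S) UNIV \<longleftrightarrow> (f has_sum S) (range (\<lambda>i. b + int i))"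
    using assms(2) by (intro has_sum_cong_neutral) (auto simp: not_less[symmetric])
  also have "\<dots>"
    using assms(1) by (subst has_sum_reindex) (auto simp: inj_on_def o_def)
  finally show ?thesis .
qed

theorem theorem3:
  fixes q a u v :: real
  assumes "0 < q" and "q < 1"
    and "0 < a" and "0 < u" and "0 < v"
    and "q_natural_exists q (\<lambda>t. E_q q (a * t)) u v"
  shows "q_natural q (\<lambda>t. E_q q (a * t)) u v
           = 1 / v * (\<Sum>n. q ^ (n * (n - 1) div 2) * (a * u / v) ^ n)"
proof -
  note q = assms(1,2)
  define w where "w = v / u"
  obtain b where b: "(1 - q) * w * q powi b = 1"
    unfolding w_def by (rule q_natural_exists_imp_lattice_zero[OF assms])
  have "0 < w" using assms by (simp add: w_def)
  define p where "p = q powi b"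
  have "0 < p" using q by (simp add: p_def)
  have p: "(1 - q) * p = u / v"
    using b assms by (simp add: p_def w_def field_simps)
  define G where "G i = q_kernel q w (b + int i)" for i
  have powi: "q powi (b + int i) = p * q ^ i" for i
    using q by (simp add: p_def power_int_add)
  have G_Suc: "G i = (1 - q ^ Suc i) * G (Suc i)" for i
  proof -
    have shift: "b + int i + 1 = b + int (Suc i)" by simp
    have "(1 - q) * w * q powi (b + int (Suc i)) = ((1 - q) * w * q powi b) * q ^ Suc i"
      unfolding powi p_def by (simp only: mult.assoc)
    then have "(1 - q) * w * q powi (b + int (Suc i)) = q ^ Suc i"
      unfolding b by simp
    then show ?thesis
      using q_kernel_recurrence[OF q, of w "b + int i"] unfolding shift G_def by (simp only:)
  qed
  have G_lim: "G \<longlonglongrightarrow> 1"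
    unfolding G_def by (rule q_kernel_tendsto_1[OF q])
  define S where "S = (\<Sum>n. q ^ (n * (n - 1) div 2) * (a * u / v) ^ n)"
  define T where "T k = q powi k * (E_q q (a * q powi k) * q_kernel q w k)" for k
  \<comment> \<open>The \<open>n\<close>-th term of the expansion of \<open>E_q (a t)\<close> at the sample point \<open>t = p q\<^sup>i\<close>, times the
    weight \<open>t\<close> of the Jackson integral and the kernel.\<close>
  define A where "A i n = E_q_coeff q n * (a * (p * q ^ i)) ^ n * (p * q ^ i * G i)" for i n
  have "((\<lambda>i. T (b + int i)) has_sum (p * S)) UNIV"
  proof (rule sums_swap_nonneg[of A "\<lambda>n. p * (q ^ (n * (n - 1) div 2) * (a * u / v) ^ n)"])
    show "0 \<le> A i n" for i n
      using pochhammer_tail_nonneg[OF q G_Suc G_lim, of i] E_q_coeff_nonneg[OF q, of n]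
        \<open>0 < p\<close> assms
      by (simp add: A_def)
    show "(\<lambda>n. A i n) sums T (b + int i)" for i
    proof -
      have "(\<lambda>n. E_q_coeff q n * (a * (p * q ^ i)) ^ n) sums E_q q (a * (p * q ^ i))"
        unfolding E_q_eq_powser by (rule summable_sums[OF summable_E_q[OF q]])
      from sums_mult2[OF this, of "p * q ^ i * G i"] show ?thesis
        by (simp add: A_def T_def powi G_def mult_ac)
    qed
    show "(\<lambda>i. A i n) sums (p * (q ^ (n * (n - 1) div 2) * (a * u / v) ^ n))" for n
    proof -
      let ?m = "(1 - q) ^ n * q_fact q n"
      have "(\<lambda>i. E_q_coeff q n * a ^ n * p ^ Suc n * (q ^ (i * Suc n) * G i))
              sums (E_q_coeff q n * a ^ n * p ^ Suc n * ?m)"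
        by (rule sums_mult[OF pochhammer_tail_moments[OF q G_Suc G_lim]])
      moreover have "E_q_coeff q n * a ^ n * p ^ Suc n * (q ^ (i * Suc n) * G i) = A i n" for i
        by (simp add: A_def power_mult_distrib power_mult power_add mult_ac)
      moreover have "E_q_coeff q n * a ^ n * p ^ Suc n * ?m
          = p * (q ^ (n * (n - 1) div 2) * (a * ((1 - q) * p)) ^ n)"
        using q_fact_ge_1[OF q, of n]
        by (simp add: E_q_coeff_def power_mult_distrib mult_ac)
      ultimately show ?thesis by (simp only: p times_divide_eq_right)
    qed
    show "(\<lambda>n. p * (q ^ (n * (n - 1) div 2) * (a * u / v) ^ n)) sums (p * S)"
      unfolding S_def by (rule sums_mult[OF summable_sums[OF summable_partial_theta[OF q]]])
  qed
  then have "(T has_sum (p * S)) UNIV"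
    by (rule has_sum_int_above) (simp add: T_def q_kernel_eq_0_below_lattice_zero[OF q b])
  then have "infsum T UNIV = p * S" by (rule infsumI)
  then have "q_natural q (\<lambda>t. E_q q (a * t)) u v = 1 / u * ((1 - q) * (p * S))"
    by (simp add: q_natural_def jackson_integral_def q_natural_integrand_def
        T_def[abs_def] q_kernel_def w_def)
  also have "\<dots> = 1 / u * ((1 - q) * p) * S" by (simp only: mult.assoc)
  also have "\<dots> = 1 / v * S" using assms unfolding p by simp
  finally show ?thesis unfolding S_def .
qed

end
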